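(* Every range-minimizing nine-triangle dissection of the unit square (that is, every dissection $D$ of the unit square into nine nondegenerate triangles with $R(D)=\Delta(9)$) lies outside the single-cap two-rail family.
   Context: A dissection of the unit square into $n$ triangles is a collection of $n$ nondegenerate (positive-area) closed triangles with pairwise disjoint interiors whose union is the square; T-junctions are allowed (a vertex of one triangle may lie in the relative interior of a side of another). If $D$ has triangle areas $a_1,\dots,a_n$, its area range is $R(D)=\max_i a_i-\min_i a_i$, and $\Delta(n)=\inf_D R(D)$ over all dissections of the unit square into $n$ nondegenerate triangles; this infimum is attained for every $n\ge2$. Single-cap two-rail family for nine triangles (up to a symmetry of the square): all nine-triangle dissections consisting of one cap having an entire side of the square as a side and an eight-step two-rail zig-zag in the complementary trapezoid, with arbitrary positive areas and arbitrary direction sequence. Explicitly, let $P=(0,0)$, $Q=(1,0)$, $T=(1,1)$, $S=(0,1)$. The cap is the triangle $STR_c$ with $R_c=(1,1-2c)$, where $c\in(0,1/2)$ is its area. The complementary trapezoid $PQR_cS$ has a lower rail, the segment $PQ$, and an upper rail, the segment $SR_c$. An eight-step two-rail zig-zag with direction sequence $s=(s_1,\dots,s_8)\in\{-1,+1\}^8$ is a cutting of this trapezoid into eight triangles of the following form: start with $p_0=P$ on the lower rail and $u_0=S$ on the upper rail; at step $i$, if $s_i=-1$ choose $p_i$ on the lower rail strictly beyond $p_{i-1}$ in the direction of $Q$, put $u_i=u_{i-1}$, and the $i$-th triangle is $p_{i-1}p_iu_{i-1}$; if $s_i=+1$ choose $u_i$ on the upper rail strictly beyond $u_{i-1}$ in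 the direction of $R_c$, put $p_i=p_{i-1}$, and the $i$-th triangle is $p_{i-1}u_{i-1}u_i$; the zig-zag must end with $p_8=Q$ and $u_8=R_c$. The nine triangles of the dissection are the cap and these eight triangles. *)

theory Defs
  imports "HOL-Analysis.Analysis"
begin

definition unit_square :: "(real^2) set" where
  "unit_square = cbox 0 1"

definition area :: "(real^2) set \<Rightarrow> real" where
  "area T = measure lebesgue T"

definition nondegenerate_triangle :: "(real^2) set \<Rightarrow> bool" where
  "nondegenerate_triangle T \<longleftrightarrow> (\<exists>a b c. T = convex hull {a, b, c}) \<and> 0 < area T"

text \<open>
  Positive areas and disjoint interiors force the triangles to be distinct, so that a set of
  triangles carries the same information as an indexed family. No condition is imposed on how
  sides meet: T-junctions are allowed.
\<close>
definition triangle_dissection :: "nat \<Rightarrow> (real^2) set set \<Rightarrow> bool" where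
  "triangle_dissection n D \<longleftrightarrow>
     finite D \<and> card D = n \<and>
     (\<forall>T\<in>D. nondegenerate_triangle T) \<and>
     pairwise (\<lambda>T U. interior T \<inter> interior U = {}) D \<and>
     \<Union>D = unit_square"

definition area_range :: "(real^2) set set \<Rightarrow> real" where
  "area_range D = Max (area ` D) - Min (area ` D)"

definition min_area_range :: "nat \<Rightarrow> real" where
  "min_area_range n = (INF D\<in>{D. triangle_dissection n D}. area_range D)"

definition square_symmetry :: "(real^2 \<Rightarrow> real^2) \<Rightarrow> bool" where
  "square_symmetry g \<longleftrightarrow> (\<forall>x y. dist (g x) (g y) = dist x y) \<and> g ` unit_square = unit_square"

text \<open>
  The point \<open>y\<close> lies on the rail ending in \<open>e\<close>, strictly beyond its point \<open>x\<close> in the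
  direction of \<open>e\<close>.
\<close>
definition strictly_beyond :: "real^2 \<Rightarrow> real^2 \<Rightarrow> real^2 \<Rightarrow> bool" where
  "strictly_beyond e x y \<longleftrightarrow> y \<in> closed_segment x e \<and> y \<noteq> x"

text \<open>
  A zig-zag with \<open>m\<close> steps between the lower rail from \<open>P\<close> to \<open>Q\<close> and the upper rail from
  \<open>S\<close> to \<open>R\<close>. Only the values \<open>s i\<close> for \<open>1 \<le> i \<le> m\<close> and \<open>p i\<close>, \<open>u i\<close> for \<open>i \<le> m\<close> matter.
\<close>
definition two_rail_zigzag ::
  "nat \<Rightarrow> real^2 \<Rightarrow> real^2 \<Rightarrow> real^2 \<Rightarrow> real^2 \<Rightarrow>
     (nat \<Rightarrow> int) \<Rightarrow> (nat \<Rightarrow> real^2) \<Rightarrow> (nat \<Rightarrow> real^2) \<Rightarrow> bool" where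
  "two_rail_zigzag m P Q S R s p u \<longleftrightarrow>
     p 0 = P \<and> u 0 = S \<and> p m = Q \<and> u m = R \<and>
     (\<forall>i\<in>{1..m}.
        (s i = -1 \<and> strictly_beyond Q (p (i - 1)) (p i) \<and> u i = u (i - 1)) \<or>
        (s i = 1 \<and> strictly_beyond R (u (i - 1)) (u i) \<and> p i = p (i - 1)))"

definition zigzag_triangle ::
  "(nat \<Rightarrow> int) \<Rightarrow> (nat \<Rightarrow> real^2) \<Rightarrow> (nat \<Rightarrow> real^2) \<Rightarrow> nat \<Rightarrow> (real^2) set" where
  "zigzag_triangle s p u i =
     (if s i = -1 then convex hull {p (i - 1), p i, u (i - 1)}
      else convex hull {p (i - 1), u (i - 1), u i})"

definition standard_single_cap_two_rail :: "(real^2) set set \<Rightarrow> bool" where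
  "standard_single_cap_two_rail D \<longleftrightarrow>
     (\<exists>c s p u. 0 < c \<and> c < 1/2 \<and>
        (let P = vector [0, 0]; Q = vector [1, 0]; T = vector [1, 1]; S = vector [0, 1];
             R = vector [1, 1 - 2 * c]
         in two_rail_zigzag 8 P Q S R s p u \<and>
            D = insert (convex hull {S, T, R}) (zigzag_triangle s p u ` {1..8})))"

definition single_cap_two_rail_family :: "(real^2) set set set" where
  "single_cap_two_rail_family =
     {D. triangle_dissection 9 D \<and>
         (\<exists>g D0. square_symmetry g \<and> standard_single_cap_two_rail D0 \<and> D = (`) g ` D0)}"

end

theory Submission imports Defs begin

text \<open>
  For a zig-zag in a trapezoid with cap area \<open>c\<close>, let \<open>x\<close> and \<open>y\<close> be the abscissae of the two moving
  points and put \<open>X = 1 - 2cx\<close>, \<open>Y = 1 - 2cy\<close>. A step cutting off area \<open>a\<close> changes only one of \<open>X\<close>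
  and \<open>Y\<close> and lowers \<open>X Y\<close> by \<open>4ca\<close>, so that \<open>X Y = 1 - 4cA\<close> with \<open>A\<close> the area cut off so far. Hence
  the step ratios of \<open>X Y\<close> split into two groups with the same product \<open>1 - 2c\<close>. If all areas
  are within \<open>1/40000\<close> of \<open>1/9\<close>, the ratios are close to \<open>(81 - 4i) / (85 - 4i)\<close>, and no subproduct of
  these is close enough to \<open>7/9\<close>. So every dissection in the family has range above \<open>1/40000\<close>.
  On the other hand, successively cutting triangles off the square, so that a convex
  quadrilateral always remains, yields a nine-triangle dissection of range below \<open>1/40000\<close>.
\<close>

section \<open>Orientation determinants, half-planes and triangles\<close>

text \<open>Twice the signed area of the triangle \<open>a b x\<close>, positive when
  \<open>x\<close> lies to the left of the line from \<open>a\<close> to \<open>b\<close>.\<close>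

definition orient :: "real^2 \<Rightarrow> real^2 \<Rightarrow> real^2 \<Rightarrow> real" where
  "orient a b x = (b$1 - a$1) * (x$2 - a$2) - (b$2 - a$2) * (x$1 - a$1)"

lemma area_triangle: "area (convex hull {a, b, c}) = \<bar>orient a b c\<bar> / 2"
proof -
  have "compact (convex hull {a, b, c})"
    by (intro finite_imp_compact_convex_hull) auto
  then have "area (convex hull {a, b, c}) = measure lborel (convex hull {a, b, c})"
    unfolding area_def by (intro measure_completion) (auto dest: compact_imp_closed)
  also have "\<dots> = \<bar>orient a b c\<bar> / 2"
    by (simp add: content_triangle orient_def abs_if algebra_simps)
  finally show ?thesis .
qed

lemma orient_self [simp]: "orient a b a = 0" "orient a b b = 0"
  by (simp_all add: orient_def)

text \<open>The normal is \<open>b - a\<close> turned by a right angle; in this form the standard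
  facts on half-spaces apply.\<close>

lemma orient_eq_inner:
  "orient a b x = vector [a$2 - b$2, b$1 - a$1] \<bullet> x - vector [a$2 - b$2, b$1 - a$1] \<bullet> a"
  by (simp add: orient_def inner_vec_def sum_2 algebra_simps)

lemma halfplane_eq_inner:
  "{x. orient a b x \<ge> 0} =
     {x. vector [a$2 - b$2, b$1 - a$1] \<bullet> x \<ge> vector [a$2 - b$2, b$1 - a$1] \<bullet> a}"
  "{x. orient a b x \<le> 0} =
     {x. vector [a$2 - b$2, b$1 - a$1] \<bullet> x \<le> vector [a$2 - b$2, b$1 - a$1] \<bullet> a}"
  by (auto simp: orient_eq_inner)

lemma interiors_halfplanes_disjoint:
  assumes "a \<noteq> b" "T \<subseteq> {x. orient a b x \<le> 0}" "U \<subseteq> {x. orient a b x \<ge> 0}"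
  shows "interior T \<inter> interior U = {}"
proof -
  let ?n = "vector [a$2 - b$2, b$1 - a$1] :: real^2"
  have "?n \<noteq> 0"
    using \<open>a \<noteq> b\<close> by (auto simp: vec_eq_iff forall_2)
  then have "interior T \<subseteq> {x. ?n \<bullet> x < ?n \<bullet> a}" "interior U \<subseteq> {x. ?n \<bullet> x > ?n \<bullet> a}"
    using interior_mono[OF assms(2)] interior_mono[OF assms(3)]
    by (simp_all add: halfplane_eq_inner)
  then show ?thesis
    by fastforce
qed

lemma hull_subset_halfplane_ge:
  assumes "\<And>v. v \<in> V \<Longrightarrow> orient a b v \<ge> 0"
  shows "convex hull V \<subseteq> {x. orient a b x \<ge> 0}"
  using assms by (intro hull_minimal) (auto simp: halfplane_eq_inner convex_halfspace_ge orient_eq_inner)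

lemma hull_subset_halfplane_le:
  assumes "\<And>v. v \<in> V \<Longrightarrow> orient a b v \<le> 0"
  shows "convex hull V \<subseteq> {x. orient a b x \<le> 0}"
  using assms by (intro hull_minimal) (auto simp: halfplane_eq_inner convex_halfspace_le orient_eq_inner)

lemma nondegenerate_triangle_interior:
  assumes "nondegenerate_triangle T"
  shows "interior T \<noteq> {}"
proof
  assume "interior T = {}"
  moreover have "convex T"
    using assms by (auto simp: nondegenerate_triangle_def)
  ultimately have "negligible T"
    using negligible_convex_interior by blast
  then have "area T = 0"
    unfolding area_def by (rule negligible_imp_measure0)
  then show False
    using assms by (simp add: nondegenerate_triangle_def)
qed

text \<open>Divided by \<open>orient a b c\<close>, the three orientations are the barycentric
  coordinates of \<open>x\<close>.\<close>

lemma in_triangle: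
  assumes "orient a b c > 0" "orient a b x \<ge> 0" "orient b c x \<ge> 0" "orient c a x \<ge> 0"
  shows "x \<in> convex hull {a, b, c}"
proof -
  let ?d = "orient a b c"
  have "orient b c x + orient c a x + orient a b x = ?d"
    by (simp add: orient_def algebra_simps)
  then have "orient b c x / ?d + orient c a x / ?d + orient a b x / ?d = 1"
    using assms(1) by (simp add: add_divide_distrib[symmetric])
  moreover have "?d *\<^sub>R x = orient b c x *\<^sub>R a + orient c a x *\<^sub>R b + orient a b x *\<^sub>R c"
    by (simp add: vec_eq_iff forall_2 orient_def algebra_simps)
  then have "x = inverse ?d *\<^sub>R (orient b c x *\<^sub>R a + orient c a x *\<^sub>R b + orient a b x *\<^sub>R c)"
    using assms(1) by (metis less_irrefl scaleR_left_imp_eq scaleR_scaleR right_inverse scaleR_one)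
  then have "x = (orient b c x / ?d) *\<^sub>R a + (orient c a x / ?d) *\<^sub>R b + (orient a b x / ?d) *\<^sub>R c"
    by (simp add: scaleR_add_right divide_inverse_commute)
  ultimately show ?thesis
    unfolding convex_hull_3 using assms
    by (intro CollectI exI[of _ "orient b c x / ?d"] exI[of _ "orient c a x / ?d"]
        exI[of _ "orient a b x / ?d"]) simp
qed

section \<open>Gluing triangles onto convex quadrilaterals\<close>

text \<open>
  For a convex quadrilateral \<open>abcd\<close> in counterclockwise order the intersection of half-planes and
  the convex hull coincide; keeping the two apart makes each inclusion pass trivially to the larger
  quadrilateral when a triangle is glued on.
\<close>
definition quad_dissection ::
  "nat \<Rightarrow> (real^2) set set \<Rightarrow> real^2 \<Rightarrow> real^2 \<Rightarrow> real^2 \<Rightarrow> real^2 \<Rightarrow> bool" where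
  "quad_dissection n D a b c d \<longleftrightarrow>
     finite D \<and> card D = n \<and>
     (\<forall>T\<in>D. nondegenerate_triangle T) \<and>
     pairwise (\<lambda>T U. interior T \<inter> interior U = {}) D \<and>
     {x. orient a b x \<ge> 0 \<and> orient b c x \<ge> 0 \<and> orient c d x \<ge> 0 \<and> orient d a x \<ge> 0} \<subseteq> \<Union>D \<and>
     \<Union>D \<subseteq> convex hull {a, b, c, d}"

lemma quad_dissection_rotate:
  "quad_dissection n D a b c d \<Longrightarrow> quad_dissection n D b c d a"
proof -
  have "{b, c, d, a} = {a, b, c, d}"
    by auto
  then show "quad_dissection n D a b c d \<Longrightarrow> quad_dissection n D b c d a"
    unfolding quad_dissection_def by auto
qed

text \<open>The line through \<open>a\<close> and \<open>b\<close> separates \<open>T\<close> from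
  the old triangles. As \<open>T\<close> has nonempty interior, it cannot be one of them, so the
  cardinality grows.\<close>

lemma insert_triangle:
  assumes "\<forall>U\<in>D. nondegenerate_triangle U" "pairwise (\<lambda>T U. interior T \<inter> interior U = {}) D"
    and "nondegenerate_triangle T" "a \<noteq> b" "finite D"
    and "T \<subseteq> {x. orient a b x \<le> 0}" "\<Union>D \<subseteq> {x. orient a b x \<ge> 0}"
  shows "card (insert T D) = Suc (card D)"
    "pairwise (\<lambda>T U. interior T \<inter> interior U = {}) (insert T D)"
proof -
  have disj: "interior T \<inter> interior U = {}" if "U \<in> D" for U
    using interiors_halfplanes_disjoint[OF assms(4,6)] assms(7) that by blast
  then have "T \<notin> D"
    using nondegenerate_triangle_interior[OF assms(3)] by blast
  then show "card (insert T D) = Suc (card D)"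
    using assms(5) by simp
  show "pairwise (\<lambda>T U. interior T \<inter> interior U = {}) (insert T D)"
    using assms(2) disj by (auto simp: pairwise_insert)
qed

lemma nondegenerate_triangle_hull:
  "orient a b c \<noteq> 0 \<Longrightarrow> nondegenerate_triangle (convex hull {a, b, c})"
  unfolding nondegenerate_triangle_def by (auto simp: area_triangle)

lemma quad_dissection_diagonal:
  assumes "orient a b c > 0" "orient a c d > 0"
  shows "quad_dissection 2 {convex hull {a, b, c}, convex hull {a, c, d}} a b c d"
proof -
  let ?T = "convex hull {a, b, c}" and ?U = "convex hull {a, c, d}"
  have nT: "nondegenerate_triangle ?T" and nU: "nondegenerate_triangle ?U"
    using assms by (auto intro: nondegenerate_triangle_hull)
  have "a \<noteq> c"
    using assms by (auto simp: orient_def)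
  have T: "?T \<subseteq> {x. orient a c x \<le> 0}"
    using assms by (intro hull_subset_halfplane_le) (auto simp: orient_def algebra_simps)
  have U: "?U \<subseteq> {x. orient a c x \<ge> 0}"
    using assms by (intro hull_subset_halfplane_ge) (auto simp: orient_def algebra_simps)
  note ins = insert_triangle[of "{?U}" ?T a c]
  have "x \<in> ?T \<union> ?U" if x: "orient a b x \<ge> 0" "orient b c x \<ge> 0" "orient c d x \<ge> 0" "orient d a x \<ge> 0" for x
  proof (cases "orient a c x \<ge> 0")
    case True
    then show ?thesis
      using x assms by (intro UnI2 in_triangle) auto
  next
    case False
    moreover have "orient c a x = - orient a c x"
      by (simp add: orient_def algebra_simps)
    ultimately show ?thesis
      using x assms by (intro UnI1 in_triangle) auto
  qed
  moreover have "?T \<subseteq> convex hull {a, b, c, d}" "?U \<subseteq> convex hull {a, b, c, d}"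
    by (auto intro!: hull_mono)
  ultimately show ?thesis
    using ins nT nU \<open>a \<noteq> c\<close> T U by (auto simp: quad_dissection_def)
qed

text \<open>The cut from \<open>a\<close> ends on \<open>b c\<close>, the side after
  \<open>a b\<close>. The segments \<open>b w\<close> and \<open>w c\<close> bound the same
  half-plane as \<open>b c\<close>, so a case split along \<open>a w\<close> places every point.
  \<open>orient a w d \<ge> 0\<close> keeps the rest on one side of the cut.\<close>

lemma quad_dissection_cut_after:
  assumes D: "quad_dissection n D a w c d"
    and w: "w = (1 - l) *\<^sub>R b + l *\<^sub>R c" "0 < l" "l < 1"
    and o: "orient a b c > 0" "orient a w d \<ge> 0"
  shows "quad_dissection (Suc n) (insert (convex hull {a, b, w}) D) a b c d"
proof -
  let ?T = "convex hull {a, b, w}"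
  have w12: "w$1 = (1 - l) * b$1 + l * c$1" "w$2 = (1 - l) * b$2 + l * c$2"
    by (simp_all add: w)
  have abw: "orient a b w = l * orient a b c" and awc: "orient a w c = (1 - l) * orient a b c"
    by (simp_all add: orient_def w12 algebra_simps)
  have awb: "orient a w b = - orient a b w"
    by (simp add: orient_def algebra_simps)
  have pos: "orient a b w > 0" "orient a w c > 0"
    using abw awc w o by simp_all
  then have "a \<noteq> w"
    by (auto simp: orient_def)
  have nT: "nondegenerate_triangle ?T"
    using pos by (auto intro: nondegenerate_triangle_hull)
  have T: "?T \<subseteq> {x. orient a w x \<le> 0}"
    using pos awb by (intro hull_subset_halfplane_le) auto
  have "convex hull {a, w, c, d} \<subseteq> {x. orient a w x \<ge> 0}"
    using pos o by (intro hull_subset_halfplane_ge) auto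
  then have U: "\<Union>D \<subseteq> {x. orient a w x \<ge> 0}"
    using D by (auto simp: quad_dissection_def)
  note ins = insert_triangle[of D ?T a w]
  have "x \<in> ?T \<union> \<Union>D"
    if x: "orient a b x \<ge> 0" "orient b c x \<ge> 0" "orient c d x \<ge> 0" "orient d a x \<ge> 0" for x
  proof (cases "orient a w x \<ge> 0")
    case True
    have "orient w c x = (1 - l) * orient b c x"
      by (simp add: orient_def w12 algebra_simps)
    then have "orient w c x \<ge> 0"
      using w x by simp
    then show ?thesis
      using True D x by (auto simp: quad_dissection_def)
  next
    case False
    have "orient b w x = l * orient b c x"
      by (simp add: orient_def w12 algebra_simps)
    moreover have "orient w a x = - orient a w x"
      by (simp add: orient_def algebra_simps)
    ultimately show ?thesis
      using False x pos w by (intro UnI1 in_triangle) auto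
  qed
  then have "{x. orient a b x \<ge> 0 \<and> orient b c x \<ge> 0 \<and> orient c d x \<ge> 0 \<and> orient d a x \<ge> 0}
      \<subseteq> ?T \<union> \<Union>D"
    by blast
  moreover have wh: "w \<in> convex hull {a, b, c, d}"
  proof -
    have "w \<in> closed_segment b c"
      using w by (auto simp: in_segment intro!: exI[of _ l])
    also have "\<dots> \<subseteq> convex hull {a, b, c, d}"
      unfolding segment_convex_hull by (auto intro!: hull_mono)
    finally show ?thesis .
  qed
  moreover have "?T \<subseteq> convex hull {a, b, c, d}" "convex hull {a, w, c, d} \<subseteq> convex hull {a, b, c, d}"
    using wh by (simp_all add: subset_hull hull_inc)
  ultimately show ?thesis
    using ins nT D \<open>a \<noteq> w\<close> T U unfolding quad_dissection_def by auto
qed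

text \<open>Mirror case: the cut from \<open>b\<close> ends on \<open>d a\<close>, the side before
  \<open>a b\<close>.\<close>

lemma quad_dissection_cut_before:
  assumes D: "quad_dissection n D w b c d"
    and w: "w = (1 - l) *\<^sub>R a + l *\<^sub>R d" "0 < l" "l < 1"
    and o: "orient a b d > 0" "orient w b c \<ge> 0"
  shows "quad_dissection (Suc n) (insert (convex hull {a, b, w}) D) a b c d"
proof -
  let ?T = "convex hull {a, b, w}"
  have w12: "w$1 = (1 - l) * a$1 + l * d$1" "w$2 = (1 - l) * a$2 + l * d$2"
    by (simp_all add: w)
  have abw: "orient a b w = l * orient a b d" and wbd: "orient w b d = (1 - l) * orient a b d"
    by (simp_all add: orient_def w12 algebra_simps)
  have wba: "orient w b a = - orient a b w"
    by (simp add: orient_def algebra_simps)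
  have pos: "orient a b w > 0" "orient w b d > 0"
    using abw wbd w o by simp_all
  then have "w \<noteq> b"
    by (auto simp: orient_def)
  have nT: "nondegenerate_triangle ?T"
    using pos by (auto intro: nondegenerate_triangle_hull)
  have T: "?T \<subseteq> {x. orient w b x \<le> 0}"
    using pos wba by (intro hull_subset_halfplane_le) auto
  have "convex hull {w, b, c, d} \<subseteq> {x. orient w b x \<ge> 0}"
    using pos o by (intro hull_subset_halfplane_ge) auto
  then have U: "\<Union>D \<subseteq> {x. orient w b x \<ge> 0}"
    using D by (auto simp: quad_dissection_def)
  note ins = insert_triangle[of D ?T w b]
  have "x \<in> ?T \<union> \<Union>D"
    if x: "orient a b x \<ge> 0" "orient b c x \<ge> 0" "orient c d x \<ge> 0" "orient d a x \<ge> 0" for x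
  proof (cases "orient w b x \<ge> 0")
    case True
    have "orient d w x = (1 - l) * orient d a x"
      by (simp add: orient_def w12 algebra_simps)
    then have "orient d w x \<ge> 0"
      using w x by simp
    then show ?thesis
      using True D x by (auto simp: quad_dissection_def)
  next
    case False
    have "orient w a x = l * orient d a x"
      by (simp add: orient_def w12 algebra_simps)
    moreover have "orient b w x = - orient w b x"
      by (simp add: orient_def algebra_simps)
    ultimately show ?thesis
      using False x pos w by (intro UnI1 in_triangle) auto
  qed
  then have "{x. orient a b x \<ge> 0 \<and> orient b c x \<ge> 0 \<and> orient c d x \<ge> 0 \<and> orient d a x \<ge> 0}
      \<subseteq> ?T \<union> \<Union>D"
    by blast
  moreover have wh: "w \<in> convex hull {a, b, c, d}"
  proof -
    have "w \<in> closed_segment a d"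
      using w by (auto simp: in_segment intro!: exI[of _ l])
    also have "\<dots> \<subseteq> convex hull {a, b, c, d}"
      unfolding segment_convex_hull by (auto intro!: hull_mono)
    finally show ?thesis .
  qed
  moreover have "?T \<subseteq> convex hull {a, b, c, d}" "convex hull {w, b, c, d} \<subseteq> convex hull {a, b, c, d}"
    using wh by (simp_all add: subset_hull hull_inc)
  ultimately show ?thesis
    using ins nT D \<open>w \<noteq> b\<close> T U unfolding quad_dissection_def by auto
qed

section \<open>Area ranges and an explicit dissection of small range\<close>

lemma area_range_le:
  assumes "finite D" "D \<noteq> {}" "\<And>T. T \<in> D \<Longrightarrow> lo \<le> area T \<and> area T \<le> hi"
  shows "area_range D \<le> hi - lo"
proof -
  have "Max (area ` D) \<le> hi" "lo \<le> Min (area ` D)"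
    using assms by auto
  then show ?thesis
    by (simp add: area_range_def)
qed

lemma area_range_nonneg:
  assumes "finite D" "D \<noteq> {}"
  shows "0 \<le> area_range D"
proof -
  have "Min (area ` D) \<le> Max (area ` D)"
    using assms by (intro Min_le Max_in) auto
  then show ?thesis
    by (simp add: area_range_def)
qed

text \<open>A real infimum is a lower bound only for sets bounded below; 0 serves here, since
  \<open>0 < n\<close> makes every dissection nonempty.\<close>

lemma min_area_range_le:
  assumes "triangle_dissection n D" "0 < n"
  shows "min_area_range n \<le> area_range D"
  unfolding min_area_range_def
proof (rule cINF_lower)
  show "bdd_below (area_range ` {D. triangle_dissection n D})"
    using assms(2) by (intro bdd_belowI2[of _ 0] area_range_nonneg) (auto simp: triangle_dissection_def)
qed (use assms in simp)

lemma ex_dissection_small_range: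
  "\<exists>D. triangle_dissection 9 D \<and> area_range D \<le> 1/40000"
proof -
  define P :: "real^2" where "P = vector [0, 0]"
  define Q :: "real^2" where "Q = vector [1, 0]"
  define T :: "real^2" where "T = vector [1, 1]"
  define S :: "real^2" where "S = vector [0, 1]"
  text \<open>
    The points \<open>w1\<close>, \<open>w2\<close>, \<open>w3\<close>, \<open>w5\<close>, \<open>w6\<close> cut off areas of exactly \<open>1/9\<close>; the points \<open>w4\<close> and \<open>w7\<close>
    are perturbed so as to spread the remaining defect over the other four triangles. The order of
    the cuts was found by a computer search.
  \<close>
  define w1 :: "real^2" where "w1 = vector [1, 2/9]"
  define w2 :: "real^2" where "w2 = vector [2/9, 4/81]"
  define w3 :: "real^2" where "w3 = vector [1, 32/63]"
  define w4 :: "real^2" where "w4 = vector [2389/4356, 2369/9801]"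
  define w5 :: "real^2" where "w5 = vector [12897/14864, 7/9]"
  define w6 :: "real^2" where "w6 = vector [5465/7432, 5/9]"
  define w7 :: "real^2" where "w7 = vector [13/158, 1843/2844]"
  note pts = P_def Q_def T_def S_def w1_def w2_def w3_def w4_def w5_def w6_def w7_def
  note comp = pts orient_def vec_eq_iff forall_2
  define D where "D = {convex hull {P, Q, w1}, convex hull {S, P, w2}, convex hull {w2, w1, w3},
    convex hull {w3, T, w4}, convex hull {T, S, w5}, convex hull {w5, S, w6},
    convex hull {w6, S, w7}, convex hull {w4, w6, w7}, convex hull {w4, w7, w2}}"
  \<comment> \<open>Assembly runs inside out: the innermost quadrilateral is split by a diagonal,
    then the other triangles are glued on. Each \<open>l\<close> locates the cut point on the side
    it divides.\<close>
  have "quad_dissection 2 {convex hull {w4, w6, w7}, convex hull {w4, w7, w2}} w4 w6 w7 w2"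
    by (rule quad_dissection_diagonal) (simp_all add: comp)
  note quad_dissection_rotate[OF this]
  note quad_dissection_cut_after[OF this, where b = S and l = "117/316"]
  then have "quad_dissection 3 {convex hull {w6, S, w7}, convex hull {w4, w6, w7},
      convex hull {w4, w7, w2}} w6 S w2 w4"
    by (simp add: comp)
  note quad_dissection_cut_before[OF this, where a = w5 and l = "1089/2627"]
  then have "quad_dissection 4 {convex hull {w5, S, w6}, convex hull {w6, S, w7},
      convex hull {w4, w6, w7}, convex hull {w4, w7, w2}} w5 S w2 w4"
    by (simp add: comp)
  note quad_dissection_cut_before[OF this, where a = T and l = "1089/3716"]
  then have "quad_dissection 5 {convex hull {T, S, w5}, convex hull {w5, S, w6},
      convex hull {w6, S, w7}, convex hull {w4, w6, w7}, convex hull {w4, w7, w2}} T S w2 w4"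
    by (simp add: comp)
  \<comment> \<open>Three rotations bring the last vertex to the front.\<close>
  note quad_dissection_rotate[OF quad_dissection_rotate[OF quad_dissection_rotate[OF this]]]
  note quad_dissection_cut_before[OF this, where a = w3 and l = "281/484"]
  then have "quad_dissection 6 {convex hull {w3, T, w4}, convex hull {T, S, w5},
      convex hull {w5, S, w6}, convex hull {w6, S, w7}, convex hull {w4, w6, w7},
      convex hull {w4, w7, w2}} w3 T S w2"
    by (simp add: comp)
  note quad_dissection_rotate[OF quad_dissection_rotate[OF quad_dissection_rotate[OF this]]]
  note quad_dissection_cut_after[OF this, where b = w1 and l = "18/49"]
  then have "quad_dissection 7 {convex hull {w2, w1, w3}, convex hull {w3, T, w4},
      convex hull {T, S, w5}, convex hull {w5, S, w6}, convex hull {w6, S, w7},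
      convex hull {w4, w6, w7}, convex hull {w4, w7, w2}} w2 w1 T S"
    by (simp add: comp)
  note quad_dissection_rotate[OF quad_dissection_rotate[OF quad_dissection_rotate[OF this]]]
  note quad_dissection_cut_after[OF this, where b = P and l = "2/9"]
  then have "quad_dissection 8 {convex hull {S, P, w2}, convex hull {w2, w1, w3},
      convex hull {w3, T, w4}, convex hull {T, S, w5}, convex hull {w5, S, w6},
      convex hull {w6, S, w7}, convex hull {w4, w6, w7}, convex hull {w4, w7, w2}} S P w1 T"
    by (simp add: comp)
  note quad_dissection_rotate[OF this]
  note quad_dissection_cut_after[OF this, where b = Q and l = "2/9"]
  then have qD: "quad_dissection 9 D P Q T S"
    by (simp add: comp D_def)
  have sq: "unit_square = {x. 0 \<le> x$1 \<and> 0 \<le> x$2 \<and> x$1 \<le> 1 \<and> x$2 \<le> 1}"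
    by (auto simp: unit_square_def mem_box_cart forall_2)
  have "convex unit_square"
    by (simp add: unit_square_def)
  then have "convex hull {P, Q, T, S} \<subseteq> unit_square"
    by (intro hull_minimal) (auto simp: sq pts)
  \<comment> \<open>The half-planes of \<open>P Q T S\<close> are the coordinate inequalities of the
    square, so both inclusions in \<open>quad_dissection\<close> meet.\<close>
  then have "\<Union>D = unit_square"
    using qD by (auto simp: quad_dissection_def sq orient_def pts)
  then have "triangle_dissection 9 D"
    using qD by (auto simp: triangle_dissection_def quad_dissection_def)
  \<comment> \<open>The bounds enclose all nine exact areas; they differ by 2491/100000000, just
    under 1/40000.\<close>
  moreover have "area_range D \<le> (1/9 + 1215/100000000) - (1/9 - 1276/100000000)"
    by (rule area_range_le) (auto simp: D_def area_triangle orient_def pts)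
  ultimately show ?thesis
    by (intro exI[of _ D]) auto
qed

section \<open>Invariance under isometries\<close>

text \<open>An isometry is an orthogonal transformation followed by a translation. Convexity and
  boundedness give measurability.\<close>

lemma area_isometry_image:
  assumes g: "\<forall>x y. dist (g x) (g y) = dist x y" and T: "convex T" "bounded T"
  shows "area (g ` T) = area T"
proof -
  define f where "f = (\<lambda>x. g x - g 0)"
  have "orthogonal_transformation f"
    using g by (simp add: orthogonal_transformation_isometry f_def dist_norm)
  then have "area (f ` T) = area T"
    unfolding area_def using T by (intro measure_orthogonal_image measurable_convex)
  moreover have "g ` T = (+) (g 0) ` f ` T"
    by (simp add: image_image f_def)
  ultimately show ?thesis
    by (simp add: area_def measure_translation)
qed

lemma area_range_isometry_image:
  assumes "\<forall>x y. dist (g x) (g y) = dist x y" "\<And>T. T \<in> D \<Longrightarrow> convex T \<and> bounded T"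
  shows "area_range ((`) g ` D) = area_range D"
proof -
  have "area ` (`) g ` D = area ` D"
    unfolding image_image using assms area_isometry_image by (intro image_cong) auto
  then show ?thesis
    by (simp add: area_range_def)
qed

section \<open>Subproducts of step ratios and their perturbation\<close>

text \<open>The ratio of step \<open>i\<close> when all nine areas are 1/9: then \<open>X Y\<close>
  is 1 - 4i/81 after \<open>i\<close> steps.\<close>

definition step_ratio :: "nat \<Rightarrow> real" where
  "step_ratio i = (81 - 4 * real i) / (85 - 4 * real i)"

text \<open>All 256 subsets are checked. 7/9 is 1 - 2c at c = 1/9. The gap exceeds the error
  266/1000000 that \<open>no_balanced_areas\<close> allows: four factors at 54/1000000 each and
  2/40000 from \<open>c\<close>.\<close>

lemma prod_step_ratio_away:
  assumes "B \<subseteq> {1..8}"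
  shows "\<bar>(\<Prod>i\<in>B. step_ratio i) - 7/9\<bar> > 28/100000"
proof -
  have key: "\<bar>(if b1 then 77/81 else 1) * ((if b2 then 73/77 else 1) * ((if b3 then 69/73 else 1) *
      ((if b4 then 65/69 else 1) * ((if b5 then 61/65 else 1) * ((if b6 then 57/61 else 1) *
      ((if b7 then 53/57 else 1) * (if b8 then 49/53 else 1))))))) - 7/9\<bar> > (28/100000 :: real)"
    for b1 b2 b3 b4 b5 b6 b7 b8
    by (cases b1; cases b2; cases b3; cases b4; cases b5; cases b6; cases b7; cases b8; simp)
  define f where "f i = (if i \<in> B then step_ratio i else 1)" for i
  have "(\<Prod>i\<in>B. step_ratio i) = (\<Prod>i\<in>{1..8} \<inter> B. step_ratio i)"
    using assms by (simp add: Int_absorb1)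
  also have "\<dots> = (\<Prod>i\<in>{1..8}. f i)"
    unfolding f_def by (rule prod.inter_restrict) simp
  also have "{1..8} = {1, 2, 3, 4, 5, 6, 7, 8::nat}"
    by (simp add: eval_nat_numeral atLeastAtMostSuc_conv insert_commute)
  finally have prod: "(\<Prod>i\<in>B. step_ratio i) = f 1 * (f 2 * (f 3 * (f 4 * (f 5 * (f 6 * (f 7 * f 8))))))"
    by simp
  have f: "f 1 = (if 1 \<in> B then 77/81 else 1)" "f 2 = (if 2 \<in> B then 73/77 else 1)"
    "f 3 = (if 3 \<in> B then 69/73 else 1)" "f 4 = (if 4 \<in> B then 65/69 else 1)"
    "f 5 = (if 5 \<in> B then 61/65 else 1)" "f 6 = (if 6 \<in> B then 57/61 else 1)"
    "f 7 = (if 7 \<in> B then 53/57 else 1)" "f 8 = (if 8 \<in> B then 49/53 else 1)"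
    by (simp_all add: f_def step_ratio_def)
  show ?thesis
    unfolding prod f by (rule key)
qed

text \<open>\<open>w\<close> and \<open>v\<close> stand for the actual and ideal \<open>X Y\<close>
  before a step; ideally this is at least 1 - 28/81 = 53/81, the value before the eighth. The error
  splits into \<open>d\<close>, that of the decrement, and \<open>f\<close>, the relative error of
  \<open>w\<close>.\<close>

lemma ratio_perturbation:
  fixes a c w v :: real
  assumes "\<bar>a - 1/9\<bar> \<le> 1/40000" "\<bar>c - 1/9\<bar> \<le> 1/40000" "\<bar>w - v\<bar> \<le> 156/1000000" "53/81 \<le> v"
  shows "\<bar>(w - 4 * c * a) / w - (v - 4/81) / v\<bar> \<le> 54/1000000"
proof -
  define d where "d = 4 * c * a - 4/81"
  define e where "e = w - v"
  have "4 * c * a = 4/81 + d" "w = v + e"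
    by (simp_all add: d_def e_def)
  define x y r where "x = a - 1/9" and "y = c - 1/9" and "r = (c - 1/9) * (a - 1/9)"
  have "d = 4/9 * x + 4/9 * y + 4 * r"
    by (simp add: d_def x_def y_def r_def field_simps)
  moreover have "\<bar>r\<bar> \<le> 1/40000 * (1/40000)"
    unfolding r_def abs_mult using assms by (intro mult_mono) auto
  ultimately have d: "\<bar>d\<bar> \<le> 2223/100000000"
    using assms(1)[folded x_def] assms(2)[folded y_def] by linarith
  have w: "w \<ge> 65/100"
    using assms(3,4) by linarith
  define f where "f = e / v"
  have eq: "(w - 4 * c * a) / w - (v - 4/81) / v = (4/81 * f - d) / w"
    using assms(4) w by (simp add: d_def e_def f_def field_simps)
  have "\<bar>f\<bar> \<le> 156/1000000 / (53/81)"
    unfolding f_def abs_divide using assms(3,4) by (intro frac_le) (auto simp: e_def)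
  then have "\<bar>f\<bar> \<le> 2385/10000000"
    by simp
  then have "\<bar>4/81 * f - d\<bar> \<le> 341/10000000"
    using d by linarith
  then have "\<bar>(4/81 * f - d) / w\<bar> \<le> 341/10000000 / (65/100)"
    unfolding abs_divide using w by (intro frac_le) auto
  also have "\<dots> \<le> 54/1000000"
    by simp
  finally show ?thesis
    by (simp only: eq)
qed

text \<open>One of \<open>B\<close> and its complement has at most four elements. Using that one is
  essential to the estimate: eight factors would allow an error of 432/1000000, more than the gap in
  \<open>prod_step_ratio_away\<close>.\<close>

lemma no_balanced_areas:
  fixes a :: "nat \<Rightarrow> real" and c :: real
  defines "w \<equiv> \<lambda>i. 1 - 4 * c * (\<Sum>j=1..i. a j)"
  assumes a: "\<And>i. i \<in> {1..8} \<Longrightarrow> \<bar>a i - 1/9\<bar> \<le> 1/40000" and c: "\<bar>c - 1/9\<bar> \<le> 1/40000"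
    and B: "B \<subseteq> {1..8}"
    and eq: "(\<Prod>i\<in>B. w i / w (i - 1)) = 1 - 2 * c" "(\<Prod>i\<in>{1..8} - B. w i / w (i - 1)) = 1 - 2 * c"
  shows False
proof -
  have w_Suc: "w i = w (i - 1) - 4 * c * a i" if "1 \<le> i" for i
    using that by (cases i) (auto simp: w_def algebra_simps)
  \<comment> \<open>Only \<open>w (i - 1)\<close> is a denominator, so \<open>i \<le> 7\<close>
    suffices. The area sum and \<open>c\<close> contribute at most 28/360000 each, and
    \<open>r\<close> a tiny product term.\<close>
  have dev: "\<bar>w i - (1 - 4 * real i / 81)\<bar> \<le> 156/1000000" if "i \<le> 7" for i
  proof -
    define A where "A = (\<Sum>j=1..i. a j) - real i / 9"
    have "A = (\<Sum>j=1..i. a j - 1/9)"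
      by (simp add: A_def sum_subtractf)
    also have "\<bar>\<dots>\<bar> \<le> (\<Sum>j=1..i. \<bar>a j - 1/9\<bar>)"
      by (rule sum_abs)
    also have "\<dots> \<le> (\<Sum>j=1..i. 1/40000)"
      using that by (intro sum_mono a) auto
    finally have A: "\<bar>A\<bar> \<le> 7/40000"
      using that by simp
    define r s where "r = (c - 1/9) * A" and "s = (c - 1/9) * (real i / 9)"
    have "w i - (1 - 4 * real i / 81) = - (4/9 * A) - 4 * s - 4 * r"
      by (simp add: w_def A_def r_def s_def field_simps)
    moreover have "\<bar>r\<bar> \<le> 1/40000 * (7/40000)"
      unfolding abs_mult r_def using A c by (intro mult_mono) auto
    moreover have "\<bar>s\<bar> \<le> 1/40000 * (7/9)"
      unfolding abs_mult s_def using that c by (intro mult_mono) auto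
    ultimately show ?thesis
      using A by linarith
  qed
  have ratio: "\<bar>w i / w (i - 1) - step_ratio i\<bar> \<le> 54/1000000" if i: "i \<in> {1..8}" for i
  proof -
    have "\<bar>(w (i-1) - 4 * c * a i) / w (i-1) - (1 - 4 * real (i - 1) / 81 - 4/81) / (1 - 4 * real (i - 1) / 81)\<bar> \<le> 54/1000000"
      using i by (intro ratio_perturbation a c dev) auto
    moreover have "(1 - 4 * real (i - 1) / 81 - 4/81) / (1 - 4 * real (i - 1) / 81) = step_ratio i"
      using i by (simp add: step_ratio_def of_nat_diff field_simps)
    ultimately show ?thesis
      using i w_Suc[of i] by simp
  qed
  \<comment> \<open>The margin 4/81 below 1 absorbs the perturbation, so both kinds of factor
    satisfy the premise of \<open>norm_prod_diff\<close>.\<close>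
  have bounds: "\<bar>step_ratio i\<bar> \<le> 1" "\<bar>w i / w (i - 1)\<bar> \<le> 1" if i: "i \<in> {1..8}" for i
  proof -
    have "0 \<le> step_ratio i" "step_ratio i \<le> 1 - 4/81"
      using i by (auto simp: step_ratio_def field_simps)
    then show "\<bar>step_ratio i\<bar> \<le> 1" "\<bar>w i / w (i - 1)\<bar> \<le> 1"
      using ratio[OF i] by linarith+
  qed
  have main: False if C: "C \<subseteq> {1..8}" "card C \<le> 4" "(\<Prod>i\<in>C. w i / w (i - 1)) = 1 - 2 * c" for C
  proof -
    have "norm ((\<Prod>i\<in>C. w i / w (i - 1)) - (\<Prod>i\<in>C. step_ratio i)) \<le>
        (\<Sum>i\<in>C. norm (w i / w (i - 1) - step_ratio i))"
      by (rule norm_prod_diff; unfold real_norm_def) (use bounds C(1) in blast)+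
    then have "\<bar>(\<Prod>i\<in>C. w i / w (i - 1)) - (\<Prod>i\<in>C. step_ratio i)\<bar> \<le> (\<Sum>i\<in>C. \<bar>w i / w (i - 1) - step_ratio i\<bar>)"
      by (simp only: real_norm_def)
    also have "\<dots> \<le> (\<Sum>i\<in>C. 54/1000000)"
      using C ratio by (intro sum_mono) auto
    also have "\<dots> \<le> 216/1000000"
      using C by simp
    finally show False
      using prod_step_ratio_away[OF C(1)] c C(3) by (auto simp: abs_if split: if_splits)
  qed
  have "card B \<le> 8"
    using card_mono[OF _ B] by simp
  then have "card B + card ({1..8} - B) = 8"
    using B by (simp add: card_Diff_subset finite_subset)
  then show False
    using main[of B] main[of "{1..8} - B"] B eq by (cases "card B \<le> 4") auto
qed

section \<open>From zig-zag geometry to products of ratios\<close>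

text \<open>\<open>B\<close> collects the lower-rail steps. They alone change \<open>X\<close>, the
  others alone change \<open>Y\<close>, and both run from 1 to 1 - 2c, whence the two
  products.\<close>

lemma standard_single_cap_two_rail_areas:
  assumes "standard_single_cap_two_rail D"
  obtains a c B where "c \<in> area ` D" "a ` {1..8} \<subseteq> area ` D"
    "c + (\<Sum>i=1..8. a i) = 1" "B \<subseteq> {1..8::nat}"
    "(\<Prod>i\<in>B. (1 - 4 * c * (\<Sum>j=1..i. a j)) / (1 - 4 * c * (\<Sum>j=1..i-1. a j))) = 1 - 2 * c"
    "(\<Prod>i\<in>{1..8} - B. (1 - 4 * c * (\<Sum>j=1..i. a j)) / (1 - 4 * c * (\<Sum>j=1..i-1. a j))) = 1 - 2 * c"
proof -
  obtain c s p u where c: "0 < c" "c < 1/2"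
    and zz: "two_rail_zigzag 8 (vector [0, 0]) (vector [1, 0]) (vector [0, 1]) (vector [1, 1 - 2 * c]) s p u"
    and D: "D = insert (convex hull {vector [0, 1], vector [1, 1], vector [1, 1 - 2 * c]})
              (zigzag_triangle s p u ` {1..8})"
    using assms unfolding standard_single_cap_two_rail_def Let_def by blast
  define x where "x i = p i $ 1" for i
  define y where "y i = u i $ 1" for i
  define a where "a i = area (zigzag_triangle s p u i)" for i
  have ends: "p 0 = vector [0, 0]" "u 0 = vector [0, 1]" "p 8 = vector [1, 0]" "u 8 = vector [1, 1 - 2 * c]"
    using zz by (auto simp: two_rail_zigzag_def)
  have step: "(s (Suc i) = -1 \<and> strictly_beyond (vector [1, 0]) (p i) (p (Suc i)) \<and> u (Suc i) = u i) \<or>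
        (s (Suc i) = 1 \<and> strictly_beyond (vector [1, 1 - 2 * c]) (u i) (u (Suc i)) \<and> p (Suc i) = p i)"
    if "i < 8" for i
    using zz that unfolding two_rail_zigzag_def by (auto dest!: bspec[where x = "Suc i"])
  have lower: "q$2 = 0 \<and> r$1 \<le> q$1 \<and> q$1 \<le> 1"
    if "strictly_beyond (vector [1, 0]) r q" "r$2 = 0" "r$1 \<le> 1" for q r :: "real^2"
  proof -
    have "q \<in> closed_segment r (vector [1, 0])"
      using that(1) by (simp add: strictly_beyond_def)
    then obtain t where t: "0 \<le> t" "t \<le> 1" "q = (1 - t) *\<^sub>R r + t *\<^sub>R vector [1, 0]"
      by (auto simp only: in_segment)
    have eq: "q$1 - r$1 = t * (1 - r$1)" "1 - q$1 = (1 - t) * (1 - r$1)"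
      by (simp_all add: t(3) algebra_simps)
    have "0 \<le> q$1 - r$1" "0 \<le> 1 - q$1"
      unfolding eq using t(1,2) that(3) by (intro mult_nonneg_nonneg; simp)+
    moreover have "q$2 = 0"
      using that(2) by (simp add: t(3))
    ultimately show ?thesis
      by simp
  qed
  have upper: "q$2 = 1 - 2 * c * q$1 \<and> r$1 \<le> q$1 \<and> q$1 \<le> 1"
    if "strictly_beyond (vector [1, 1 - 2 * c]) r q" "r$2 = 1 - 2 * c * r$1" "r$1 \<le> 1" for q r :: "real^2"
  proof -
    have "q \<in> closed_segment r (vector [1, 1 - 2 * c])"
      using that(1) by (simp add: strictly_beyond_def)
    then obtain t where t: "0 \<le> t" "t \<le> 1" "q = (1 - t) *\<^sub>R r + t *\<^sub>R vector [1, 1 - 2 * c]"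
      by (auto simp only: in_segment)
    have eq: "q$1 - r$1 = t * (1 - r$1)" "1 - q$1 = (1 - t) * (1 - r$1)"
      by (simp_all add: t(3) algebra_simps)
    have "0 \<le> q$1 - r$1" "0 \<le> 1 - q$1"
      unfolding eq using t(1,2) that(3) by (intro mult_nonneg_nonneg; simp)+
    moreover have "q$2 = 1 - 2 * c * q$1"
      by (simp add: t(3) that(2)) (simp add: algebra_simps)
    ultimately show ?thesis
      by simp
  qed
  have rails: "p i $ 2 = 0 \<and> 0 \<le> x i \<and> x i \<le> 1 \<and> u i $ 2 = 1 - 2 * c * y i \<and> 0 \<le> y i \<and> y i \<le> 1"
    if "i \<le> 8" for i
    using that
  proof (induction i)
    case 0
    then show ?case
      by (simp add: ends x_def y_def)
  next
    case (Suc i)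
    then have IH: "p i $ 2 = 0" "0 \<le> p i $ 1" "p i $ 1 \<le> 1" "u i $ 2 = 1 - 2 * c * u i $ 1"
        "0 \<le> u i $ 1" "u i $ 1 \<le> 1" and "i < 8"
      by (auto simp: x_def y_def)
    from step[OF \<open>i < 8\<close>] show ?case
    proof (elim disjE conjE)
      assume *: "strictly_beyond (vector [1, 0]) (p i) (p (Suc i))" "u (Suc i) = u i"
      show ?thesis
        using lower[OF *(1) IH(1,3)] IH *(2) by (simp add: x_def y_def)
    next
      assume *: "strictly_beyond (vector [1, 1 - 2 * c]) (u i) (u (Suc i))" "p (Suc i) = p i"
      show ?thesis
        using upper[OF *(1) IH(4,6)] IH *(2) by (simp add: x_def y_def)
    qed
  qed
  \<comment> \<open>\<open>X i\<close> is the height of the upper rail above \<open>p i\<close>, and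
    \<open>Y i\<close> the height of \<open>u i\<close>; both are positive because c < 1/2.\<close>
  define X where "X i = 1 - 2 * c * x i" for i
  define Y where "Y i = 1 - 2 * c * y i" for i
  have pos: "X i > 0" "Y i > 0" if "i \<le> 8" for i
  proof -
    have "2 * c * x i \<le> 2 * c * 1" "2 * c * y i \<le> 2 * c * 1"
      using rails[OF that] c by (intro mult_left_mono; simp)+
    then show "X i > 0" "Y i > 0"
      unfolding X_def Y_def using c by linarith+
  qed
  have area_step: "(s (Suc i) = -1 \<and> Y (Suc i) = Y i \<or> s (Suc i) = 1 \<and> X (Suc i) = X i) \<and>
      X (Suc i) * Y (Suc i) = X i * Y i - 4 * c * a (Suc i)" if i: "i < 8" for i
  proof -
    have r: "p i $ 2 = 0" "u i $ 2 = Y i" "p (Suc i) $ 2 = 0" "u (Suc i) $ 2 = Y (Suc i)"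
      "p i $ 1 \<le> 1" "u i $ 1 \<le> 1"
      using rails[of i] rails[of "Suc i"] i by (auto simp: x_def y_def Y_def)
    have pos': "0 < X i" "0 < Y i"
      using pos[of i] i by auto
    from step[OF i] show ?thesis
    proof (elim disjE conjE)
      assume *: "s (Suc i) = -1" "strictly_beyond (vector [1, 0]) (p i) (p (Suc i))" "u (Suc i) = u i"
      have "orient (p i) (p (Suc i)) (u i) = (x (Suc i) - x i) * Y i"
        by (simp add: orient_def r x_def)
      moreover have "x i \<le> x (Suc i)"
        using lower[OF *(2) r(1,5)] by (simp add: x_def)
      ultimately have ai: "a (Suc i) = (x (Suc i) - x i) * Y i / 2"
        using pos' * by (simp add: a_def zigzag_triangle_def area_triangle abs_mult)
      have "4 * c * a (Suc i) = (X i - X (Suc i)) * Y i"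
        unfolding ai X_def by (simp add: field_simps)
      moreover have "Y (Suc i) = Y i"
        using *(3) by (simp add: Y_def y_def)
      ultimately show ?thesis
        using *(1) by (simp add: algebra_simps)
    next
      assume *: "s (Suc i) = 1" "strictly_beyond (vector [1, 1 - 2 * c]) (u i) (u (Suc i))" "p (Suc i) = p i"
      \<comment> \<open>Twice the area is the vertical distance \<open>X i\<close> from
        \<open>p i\<close> to the upper rail times the horizontal width of the side. The sign
        reflects the clockwise vertex order.\<close>
      have "orient (p i) (u i) (u (Suc i)) = - ((y (Suc i) - y i) * X i)"
        by (simp add: orient_def r x_def y_def X_def Y_def algebra_simps)
      moreover have "y i \<le> y (Suc i)"
        using upper[OF *(2) r(2)[unfolded Y_def y_def] r(6)] by (simp add: y_def)
      ultimately have ai: "a (Suc i) = (y (Suc i) - y i) * X i / 2"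
        using pos' * by (simp add: a_def zigzag_triangle_def area_triangle abs_mult)
      have "4 * c * a (Suc i) = (Y i - Y (Suc i)) * X i"
        unfolding ai Y_def by (simp add: field_simps)
      moreover have "X (Suc i) = X i"
        using *(3) by (simp add: X_def x_def)
      ultimately show ?thesis
        using *(1) by (simp add: algebra_simps)
    qed
  qed
  define w where "w i = 1 - 4 * c * (\<Sum>j=1..i. a j)" for i
  have w: "X i * Y i = w i" if "i \<le> 8" for i
    using that
  proof (induction i)
    case 0
    then show ?case
      by (simp add: w_def X_def Y_def x_def y_def ends)
  next
    case (Suc i)
    then show ?case
      using area_step[of i] by (simp add: w_def algebra_simps)
  qed
  define B where "B = {i \<in> {1..8}. s i = -1}"
  have XY_step: "X (Suc i) = X i * (if s (Suc i) = -1 then w (Suc i) / w i else 1)"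
       "Y (Suc i) = Y i * (if s (Suc i) = -1 then 1 else w (Suc i) / w i)" if i: "i < 8" for i
  proof -
    have "X i \<noteq> 0" "Y i \<noteq> 0" "w i = X i * Y i" "w (Suc i) = X (Suc i) * Y (Suc i)"
      using pos[of i] w[of i] w[of "Suc i"] i by auto
    then show "X (Suc i) = X i * (if s (Suc i) = -1 then w (Suc i) / w i else 1)"
       "Y (Suc i) = Y i * (if s (Suc i) = -1 then 1 else w (Suc i) / w i)"
      using area_step[OF i, THEN conjunct1] by auto
  qed
  \<comment> \<open>Steps on the other rail enter with the default factor 1.\<close>
  have XY: "X n = (\<Prod>i=1..n. if s i = -1 then w i / w (i - 1) else 1) \<and>
        Y n = (\<Prod>i=1..n. if s i = -1 then 1 else w i / w (i - 1))" if "n \<le> 8" for n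
    using that
  proof (induction n)
    case 0
    then show ?case
      by (simp add: X_def Y_def x_def y_def ends)
  next
    case (Suc n)
    then show ?case
      using XY_step[of n] by simp
  qed
  have end8: "X 8 = 1 - 2 * c" "Y 8 = 1 - 2 * c"
    by (simp_all add: X_def Y_def x_def y_def ends)
  have prodB: "(\<Prod>i\<in>B. w i / w (i - 1)) = 1 - 2 * c"
  proof -
    have "(\<Prod>i\<in>B. w i / w (i - 1)) = (\<Prod>i=1..8. if s i = -1 then w i / w (i - 1) else 1)"
      unfolding B_def by (rule prod.inter_filter) simp
    then show ?thesis
      using XY[of 8] end8 by simp
  qed
  have prodB': "(\<Prod>i\<in>{1..8} - B. w i / w (i - 1)) = 1 - 2 * c"
  proof -
    have "{1..8} - B = {i \<in> {1..8}. s i \<noteq> -1}"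
      by (auto simp: B_def)
    then have "(\<Prod>i\<in>{1..8} - B. w i / w (i - 1)) = (\<Prod>i=1..8. if s i \<noteq> -1 then w i / w (i - 1) else 1)"
      using prod.inter_filter[of "{1..8}" "\<lambda>i. w i / w (i - 1)" "\<lambda>i. s i \<noteq> -1"] by simp
    also have "\<dots> = (\<Prod>i=1..8. if s i = -1 then 1 else w i / w (i - 1))"
      by (intro prod.cong) auto
    finally show ?thesis
      using XY[of 8] end8 by simp
  qed
  \<comment> \<open>The final value of \<open>X Y\<close> gives (1 - 2c)^2 = 1 - 4c times the sum of
    the \<open>a i\<close>; cancelling \<open>4 * c\<close> yields total area 1.\<close>
  have "(1 - 2 * c) * (1 - 2 * c) = w 8"
    using w[of 8] end8 by simp
  then have "4 * c * (c + (\<Sum>i=1..8. a i)) = 4 * c * 1"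
    by (simp add: w_def algebra_simps)
  then have "c + (\<Sum>i=1..8. a i) = 1"
    using c by simp
  moreover have "area (convex hull {vector [0, 1], vector [1, 1], vector [1, 1 - 2 * c]}) = c"
    using c by (simp add: area_triangle orient_def)
  then have "c \<in> area ` D"
    unfolding D by (metis image_eqI insertI1)
  moreover have "a ` {1..8} \<subseteq> area ` D"
    by (auto simp: D a_def)
  moreover have "B \<subseteq> {1..8}"
    by (auto simp: B_def)
  ultimately show thesis
    using that prodB prodB' by (simp add: w_def)
qed

text \<open>The nine areas, counted by index, average 1/9, which therefore lies between minimum and
  maximum. A range of at most 1/40000 then puts every area within 1/40000 of 1/9.\<close>

lemma standard_single_cap_two_rail_range:
  assumes "standard_single_cap_two_rail D" "finite D"
  shows "area_range D > 1/40000"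
proof (rule ccontr)
  assume "\<not> area_range D > 1/40000"
  then have range: "Max (area ` D) - Min (area ` D) \<le> 1/40000"
    by (simp add: area_range_def)
  obtain a c B where c: "c \<in> area ` D" and a: "a ` {1..8} \<subseteq> area ` D"
    and sum: "c + (\<Sum>i=1..8. a i) = 1" and B: "B \<subseteq> {1..8::nat}"
    and eq: "(\<Prod>i\<in>B. (1 - 4 * c * (\<Sum>j=1..i. a j)) / (1 - 4 * c * (\<Sum>j=1..i-1. a j))) = 1 - 2 * c"
    "(\<Prod>i\<in>{1..8} - B. (1 - 4 * c * (\<Sum>j=1..i. a j)) / (1 - 4 * c * (\<Sum>j=1..i-1. a j))) = 1 - 2 * c"
    by (rule standard_single_cap_two_rail_areas[OF assms(1)]) (rule that)
  have bd: "Min (area ` D) \<le> z \<and> z \<le> Max (area ` D)" if "z \<in> area ` D" for z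
    using that assms(2) by auto
  have ai: "Min (area ` D) \<le> a i" "a i \<le> Max (area ` D)" if "i \<in> {1..8}" for i
    using bd a that by blast+
  have "(\<Sum>i=1..8. a i) \<le> of_nat (card {1..8::nat}) * Max (area ` D)"
    by (rule sum_bounded_above) (rule ai)
  moreover have "(\<Sum>i=1..8. a i) \<ge> of_nat (card {1..8::nat}) * Min (area ` D)"
    by (rule sum_bounded_below) (rule ai)
  ultimately have "Min (area ` D) \<le> 1/9" "1/9 \<le> Max (area ` D)"
    using sum bd[OF c] by auto
  then have near: "\<bar>z - 1/9\<bar> \<le> 1/40000" if "z \<in> area ` D" for z
    using bd[OF that] range by linarith
  have "\<bar>a i - 1/9\<bar> \<le> 1/40000" if "i \<in> {1..8}" for i
    using near a that by blast
  then show False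
    using no_balanced_areas[OF _ near[OF c] B eq] by blast
qed

section \<open>Comparison of the two bounds\<close>

theorem corollary4:
  fixes D :: "(real^2) set set"
  assumes "triangle_dissection 9 D"
    and "area_range D = min_area_range 9"
  shows "D \<notin> single_cap_two_rail_family"
proof
  assume "D \<in> single_cap_two_rail_family"
  then obtain g D0 where g: "\<forall>x y. dist (g x) (g y) = dist x y"
    and D0: "standard_single_cap_two_rail D0" and D: "D = (`) g ` D0"
    by (auto simp: single_cap_two_rail_family_def square_symmetry_def)
  obtain c s p u where "D0 = insert (convex hull {vector [0, 1], vector [1, 1], vector [1, 1 - 2 * c]})
      (zigzag_triangle s p u ` {1..8})"
    using D0 unfolding standard_single_cap_two_rail_def Let_def by blast
  then have fin: "finite D0" and conv: "\<And>T. T \<in> D0 \<Longrightarrow> convex T \<and> bounded T"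
    by (auto simp: zigzag_triangle_def intro!: finite_imp_bounded_convex_hull)
  \<comment> \<open>The strict lower bound for \<open>D0\<close> passes through the symmetry to the
    minimum and contradicts the weak upper bound of the explicit dissection.\<close>
  have "1/40000 < area_range D0"
    by (rule standard_single_cap_two_rail_range[OF D0 fin])
  also have "\<dots> = min_area_range 9"
    using area_range_isometry_image[OF g conv] assms(2) by (simp add: D)
  also obtain D' where "triangle_dissection 9 D'" "area_range D' \<le> 1/40000"
    using ex_dissection_small_range by blast
  then have "min_area_range 9 \<le> 1/40000"
    using min_area_range_le[of 9 D'] by simp
  finally show False
    by simp
qed

end
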